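(* Let $(M,d)$ be a metric space, let $\gamma:[a,b]\to(M,d)$ be a rectifiable path, and let $\rho$ be a metric on $M$ which is locally Lipschitz equivalent to $d$. Then $\gamma:[a,b]\to(M,\rho)$ is also rectifiable. Moreover, if $\gamma:[a,b]\to(M,d)$ is Lipschitz, then $\gamma:[a,b]\to(M,\rho)$ is also Lipschitz.
   Context: Two metrics $d,\rho$ on a set $M$ are locally Lipschitz equivalent if they induce the same topology on $M$ and for every $p\in M$ there exist constants $c_p,C_p>0$ and a neighborhood $V_p$ of $p$ such that $c_p\,d(x,y)\le\rho(x,y)\le C_p\,d(x,y)$ for all $x,y\in V_p$. A path $\gamma:[a,b]\to(M,d)$ is a continuous map; its length is $\ell_d(\gamma)=\sup\sum_i d(\gamma(t_i),\gamma(t_{i-1}))$ over partitions of $[a,b]$, and it is rectifiable if $\ell_d(\gamma)<\infty$. *)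

theory Defs
  imports "HOL-Analysis.Analysis"
begin

text \<open>A metric space $(M,d)$ is a value \<open>m\<close> of the library type \<open>'a metric\<close>, with
  \<open>mspace m\<close> the set $M$ and \<open>mdist m\<close> the distance function $d$ on it.\<close>

text \<open>Only the values of \<open>g\<close> on $[a,b]$ matter in the definitions below.\<close>

definition path_in :: "real \<Rightarrow> real \<Rightarrow> 'a metric \<Rightarrow> (real \<Rightarrow> 'a) \<Rightarrow> bool" where
  "path_in a b m g \<longleftrightarrow> continuous_map (top_of_set {a..b}) (mtopology_of m) g"

definition partition_points :: "real \<Rightarrow> real \<Rightarrow> nat \<Rightarrow> (nat \<Rightarrow> real) \<Rightarrow> bool" where
  "partition_points a b n t \<longleftrightarrow> t 0 = a \<and> t n = b \<and> (\<forall>i<n. t i \<le> t (Suc i))"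

text \<open>The length is extended-real valued, so that the supremum always exists.\<close>

definition length_in :: "real \<Rightarrow> real \<Rightarrow> 'a metric \<Rightarrow> (real \<Rightarrow> 'a) \<Rightarrow> ennreal" where
  "length_in a b m g =
     Sup {ennreal (\<Sum>i=1..n. mdist m (g (t i)) (g (t (i - 1)))) | n t. partition_points a b n t}"

definition rectifiable_path_in :: "real \<Rightarrow> real \<Rightarrow> 'a metric \<Rightarrow> (real \<Rightarrow> 'a) \<Rightarrow> bool" where
  "rectifiable_path_in a b m g \<longleftrightarrow> path_in a b m g \<and> length_in a b m g < \<infinity>"

text \<open>Neighbourhoods need not be open. Since the two topologies are required to agree, it does not
  matter which one they refer to; equality of the topologies includes equality of the carriers.\<close>

definition locally_Lipschitz_equivalent :: "'a metric \<Rightarrow> 'a metric \<Rightarrow> bool" where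
  "locally_Lipschitz_equivalent m m' \<longleftrightarrow>
     mtopology_of m = mtopology_of m' \<and>
     (\<forall>p \<in> mspace m. \<exists>c>0. \<exists>C>0. \<exists>V \<subseteq> mspace m.
        (\<exists>U. openin (mtopology_of m) U \<and> p \<in> U \<and> U \<subseteq> V) \<and>
        (\<forall>x \<in> V. \<forall>y \<in> V. c * mdist m x y \<le> mdist m' x y \<and> mdist m' x y \<le> C * mdist m x y))"

end

theory Submission
  imports Defs
begin

text \<open>The ratio \<open>\<rho> / d\<close> is locally bounded on \<open>M \<times> M\<close>: near the diagonal by the local Lipschitz
  condition, and away from it because there \<open>d\<close> is locally bounded below and \<open>\<rho>\<close> is locally
  bounded above. So it is bounded on \<open>S \<times> S\<close> for every compact \<open>S\<close>. With \<open>S\<close> the image of the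
  path this gives one constant \<open>K\<close> with \<open>\<rho> \<le> K d\<close> along the whole path.\<close>

text \<open>A finite subcover leaves finitely many constants, and since \<open>P\<close> is monotone
  in its first argument their maximum serves everywhere on \<open>S\<close>.\<close>

lemma compactin_locally_bounded_imp_bounded:
  fixes P :: "real \<Rightarrow> 'a \<Rightarrow> bool"
  assumes S: "compactin X S"
    and mono: "\<And>K L x. P K x \<Longrightarrow> K \<le> L \<Longrightarrow> P L x"
    and loc: "\<And>x. x \<in> S \<Longrightarrow> \<exists>U K. openin X U \<and> x \<in> U \<and> (\<forall>y\<in>U. P K y)"
  shows "\<exists>K. \<forall>x\<in>S. P K x"
proof -
  let ?\<U> = "{U. openin X U \<and> (\<exists>K. \<forall>y\<in>U. P K y)}"
  have "S \<subseteq> \<Union>?\<U>"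
    using loc by blast
  then obtain \<F> where F: "finite \<F>" "\<F> \<subseteq> ?\<U>" "S \<subseteq> \<Union>\<F>"
    using compactinD[OF S, of ?\<U>] by blast
  then have "\<forall>U\<in>\<F>. \<exists>K. \<forall>y\<in>U. P K y"
    by blast
  then obtain k where k: "\<And>U y. U \<in> \<F> \<Longrightarrow> y \<in> U \<Longrightarrow> P (k U) y"
    by metis
  show ?thesis
  proof (intro exI ballI)
    fix x assume "x \<in> S"
    then obtain U where U: "U \<in> \<F>" "x \<in> U"
      using F by blast
    then show "P (Max (k ` \<F>)) x"
      using mono[OF k[OF U]] F(1) by simp
  qed
qed

text \<open>The off-diagonal case: near two distinct points the triangle inequality keeps
  \<open>mdist m\<close> away from zero and \<open>mdist m'\<close> bounded, which bounds their
  quotient.\<close>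

lemma mdist_locally_bounded_ratio:
  assumes top: "mtopology_of m = mtopology_of m'"
    and xy: "x \<in> mspace m" "y \<in> mspace m" "x \<noteq> y"
  shows "\<exists>U V K. openin (mtopology_of m) U \<and> openin (mtopology_of m) V \<and> x \<in> U \<and> y \<in> V \<and>
    (\<forall>u\<in>U. \<forall>v\<in>V. mdist m' u v \<le> K * mdist m u v)"
proof -
  have sp: "mspace m' = mspace m"
    using top by (metis topspace_mtopology_of)
  \<comment> \<open>A quarter of the distance: moving each endpoint by less than \<open>r\<close>
    costs at most \<open>2 * r\<close> of \<open>4 * r\<close>, so \<open>2 * r\<close> remains as a
    lower bound.\<close>
  define r where "r = mdist m x y / 4"
  have r: "r > 0"
    using xy by (simp add: r_def order_less_le)
  \<comment> \<open>The upper bound for \<open>mdist m'\<close> divided by the lower bound for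
    \<open>mdist m\<close>.\<close>
  define K where "K = (mdist m' x y + 2) / (2 * r)"
  \<comment> \<open>The \<open>m\<close>-ball serves the lower bound, the \<open>m'\<close>-ball of
    radius 1 the upper one. Equality of the topologies makes the second ball open for
    \<open>m\<close> too.\<close>
  define B where "B = (\<lambda>z. mball_of m z r \<inter> mball_of m' z 1)"
  have op: "openin (mtopology_of m) (B z)" for z
    unfolding B_def
    by (metis Metric_space.openin_mball Metric_space_mspace_mdist mball_of_def mtopology_of_def
        openin_Int top)
  have le: "mdist m' u v \<le> K * mdist m u v" if "u \<in> B x" "v \<in> B y" for u v
  proof -
    have u: "u \<in> mspace m" "mdist m x u < r" "mdist m' x u < 1"
      and v: "v \<in> mspace m" "mdist m y v < r" "mdist m' y v < 1"
      using that by (auto simp: B_def)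
    have "mdist m x y \<le> mdist m x u + mdist m u v + mdist m y v"
      using mdist_triangle[of x m u y] mdist_triangle[of u m v y] u v xy mdist_commute[of m v y] by linarith
    then have lb: "2 * r \<le> mdist m u v"
      using u v by (simp add: r_def)
    have "mdist m' u v \<le> mdist m' x u + mdist m' x y + mdist m' y v"
      using mdist_triangle[of u m' x v] mdist_triangle[of x m' y v] u v xy sp mdist_commute[of m' u x] by simp
    also have "\<dots> \<le> mdist m' x y + 2"
      using u v by simp
    also have "\<dots> = K * (2 * r)"
      using r by (simp add: K_def)
    also have "\<dots> \<le> K * mdist m u v"
      using lb r by (intro mult_left_mono) (simp_all add: K_def)
    finally show ?thesis .
  qed
  have "x \<in> B x" "y \<in> B y"
    using xy r sp by (simp_all add: B_def mdist_zero[THEN iffD2] del: mdist_zero)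
  then show ?thesis
    using op le by blast
qed

text \<open>Compactness is applied to pairs, in \<open>S \<times> S\<close>, because a cover of
  \<open>S\<close> alone would only compare points lying in a common neighbourhood.\<close>

lemma locally_Lipschitz_equivalent_compactin_bound:
  assumes lip: "locally_Lipschitz_equivalent m m'"
    and S: "compactin (mtopology_of m) S"
  shows "\<exists>K\<ge>0. \<forall>x\<in>S. \<forall>y\<in>S. mdist m' x y \<le> K * mdist m x y"
proof -
  let ?X = "mtopology_of m"
  let ?P = "\<lambda>K (x, y). mdist m' x y \<le> K * mdist m x y"
  have sub: "S \<subseteq> mspace m"
    using compactin_subset_topspace[OF S] by simp
  have "\<exists>K. \<forall>p\<in>S \<times> S. ?P K p"
  proof (rule compactin_locally_bounded_imp_bounded)
    show "compactin (prod_topology ?X ?X) (S \<times> S)"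
      using S by (simp add: compactin_Times)
    show "?P L p" if "?P K p" "K \<le> L" for K L p
      using that mult_right_mono[OF that(2) mdist_nonneg[of m "fst p" "snd p"]]
      by (simp add: case_prod_beta)
    fix p assume "p \<in> S \<times> S"
    then obtain x y where p: "p = (x, y)" and xy: "x \<in> mspace m" "y \<in> mspace m"
      using sub by blast
    have "\<exists>U V K. openin ?X U \<and> openin ?X V \<and> x \<in> U \<and> y \<in> V \<and>
        (\<forall>u\<in>U. \<forall>v\<in>V. mdist m' u v \<le> K * mdist m u v)"
    proof (cases "x = y")
      case True
      obtain C V U where CVU: "openin ?X U" "x \<in> U" "U \<subseteq> V"
        "\<forall>u\<in>V. \<forall>v\<in>V. mdist m' u v \<le> C * mdist m u v"
        using lip xy(1) unfolding locally_Lipschitz_equivalent_def by meson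
      \<comment> \<open>At a diagonal point the square of a Lipschitz neighbourhood is the required
        product neighbourhood.\<close>
      have "openin ?X U \<and> openin ?X U \<and> x \<in> U \<and> y \<in> U \<and>
          (\<forall>u\<in>U. \<forall>v\<in>U. mdist m' u v \<le> C * mdist m u v)"
        using CVU True by auto
      then show ?thesis
        by (intro exI)
    next
      case False
      then show ?thesis
        using mdist_locally_bounded_ratio[OF _ xy] lip by (simp add: locally_Lipschitz_equivalent_def)
    qed
    then obtain U V K where "openin ?X U" "openin ?X V" "x \<in> U" "y \<in> V"
      "\<forall>u\<in>U. \<forall>v\<in>V. mdist m' u v \<le> K * mdist m u v"
      by blast
    then have "openin (prod_topology ?X ?X) (U \<times> V) \<and> p \<in> U \<times> V \<and> (\<forall>q\<in>U \<times> V. ?P K q)"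
      by (simp add: openin_prod_Times_iff p)
    then show "\<exists>W K. openin (prod_topology ?X ?X) W \<and> p \<in> W \<and> (\<forall>q\<in>W. ?P K q)"
      by blast
  qed
  then obtain K where K: "\<forall>x\<in>S. \<forall>y\<in>S. mdist m' x y \<le> K * mdist m x y"
    by auto
  \<comment> \<open>The covering argument says nothing about the sign of \<open>K\<close>, which may
    be negative if \<open>S\<close> has at most one point.\<close>
  have "mdist m' x y \<le> max K 0 * mdist m x y" if "x \<in> S" "y \<in> S" for x y
    using K that by (meson order_trans mult_right_mono max.cobounded1 mdist_nonneg)
  then show ?thesis
    by (meson max.cobounded2)
qed

lemma partition_points_in_Icc:
  assumes t: "partition_points a b n t" and i: "i \<le> n"
  shows "t i \<in> {a..b}"
proof -
  have mono: "\<And>j. j < n \<Longrightarrow> t j \<le> t (Suc j)"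
    using t by (simp add: partition_points_def)
  have "t j \<le> t k" if "j \<le> k" "k \<le> n" for j k
    using that
  proof (induction k rule: dec_induct)
    case (step k)
    then show ?case
      using mono[of k] by simp
  qed simp
  from this[of 0 i] this[of i n] show ?thesis
    using t i by (simp add: partition_points_def)
qed

text \<open>Each partition sum is compared term by term. All partition points lie in the interval,
  so a bound along the path is enough.\<close>

lemma length_in_le_mult:
  assumes K: "K \<ge> 0"
    and le: "\<And>s t. s \<in> {a..b} \<Longrightarrow> t \<in> {a..b} \<Longrightarrow> mdist m' (g s) (g t) \<le> K * mdist m (g s) (g t)"
  shows "length_in a b m' g \<le> ennreal K * length_in a b m g"
  unfolding length_in_def[of a b m']
proof (rule Sup_least, clarify)
  fix n t assume t: "partition_points a b n t"
  let ?s = "\<lambda>m. \<Sum>i=1..n. mdist m (g (t i)) (g (t (i - 1)))"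
  have "?s m' \<le> (\<Sum>i=1..n. K * mdist m (g (t i)) (g (t (i - 1))))"
    by (intro sum_mono le partition_points_in_Icc[OF t]) auto
  then have "ennreal (?s m') \<le> ennreal K * ennreal (?s m)"
    using K by (simp add: ennreal_mult'[symmetric] ennreal_leI sum_distrib_left)
  also have "\<dots> \<le> ennreal K * length_in a b m g"
    unfolding length_in_def using t by (intro mult_left_mono Sup_upper) auto
  finally show "ennreal (?s m') \<le> ennreal K * length_in a b m g" .
qed

theorem proposition6p1:
  fixes M :: "'a set" and d \<rho> :: "'a metric"
    and a b :: real and \<gamma> :: "real \<Rightarrow> 'a"
  assumes "mspace d = M" and "mspace \<rho> = M"
    and "a \<le> b"
    and "rectifiable_path_in a b d \<gamma>"
    and "locally_Lipschitz_equivalent d \<rho>"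
  shows "rectifiable_path_in a b \<rho> \<gamma> \<and>
    (Lipschitz_continuous_map (submetric euclidean_metric {a..b}) d \<gamma> \<longrightarrow>
     Lipschitz_continuous_map (submetric euclidean_metric {a..b}) \<rho> \<gamma>)"
proof -
  have path: "path_in a b d \<gamma>" and len: "length_in a b d \<gamma> < \<infinity>"
    using assms(4) by (simp_all add: rectifiable_path_in_def)
  \<comment> \<open>Compactness of the interval, carried over by continuity, yields one constant
    \<open>K\<close> for the whole path. It controls both the length and the Lipschitz
    constant.\<close>
  have "compactin (mtopology_of d) (\<gamma> ` {a..b})"
    using path unfolding path_in_def
    by (intro image_compactin[of "top_of_set {a..b}"]) (auto simp: compactin_subtopology)
  then obtain K where K: "K \<ge> 0"
    and le: "\<And>s t. s \<in> {a..b} \<Longrightarrow> t \<in> {a..b} \<Longrightarrow> mdist \<rho> (\<gamma> s) (\<gamma> t) \<le> K * mdist d (\<gamma> s) (\<gamma> t)"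
    using locally_Lipschitz_equivalent_compactin_bound[OF assms(5)] by blast
  have "path_in a b \<rho> \<gamma>"
    using path assms(5) by (simp add: path_in_def locally_Lipschitz_equivalent_def)
  moreover have "length_in a b \<rho> \<gamma> < \<infinity>"
    using len by (intro order_le_less_trans[OF length_in_le_mult[OF K le]])
      (simp_all add: ennreal_mult_less_top)
  moreover have "Lipschitz_continuous_map (submetric euclidean_metric {a..b}) \<rho> \<gamma>"
    if L: "Lipschitz_continuous_map (submetric euclidean_metric {a..b}) d \<gamma>"
  proof -
    obtain B where im: "\<gamma> \<in> {a..b} \<rightarrow> mspace d"
      and B: "\<And>s t. s \<in> {a..b} \<Longrightarrow> t \<in> {a..b} \<Longrightarrow> mdist d (\<gamma> s) (\<gamma> t) \<le> B * dist s t"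
      using L by (auto simp: Lipschitz_continuous_map_def simp del: atLeastAtMost_iff)
    \<comment> \<open>Lipschitz constants multiply: \<open>B\<close> for the path in
      \<open>d\<close>, \<open>K\<close> for passing from \<open>d\<close> to
      \<open>\<rho>\<close>.\<close>
    have "mdist \<rho> (\<gamma> s) (\<gamma> t) \<le> K * B * dist s t" if "s \<in> {a..b}" "t \<in> {a..b}" for s t
      using le[OF that] mult_left_mono[OF B[OF that] K] by (simp add: mult.assoc)
    then show ?thesis
      using im assms(1,2) by (auto simp: Lipschitz_continuous_map_def simp del: atLeastAtMost_iff)
  qed
  ultimately show ?thesis
    by (simp add: rectifiable_path_in_def)
qed

end
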